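(* Let $\mathcal A$ be a unital commutative ring, let $1\le m\le n$ be integers, put $N=\binom{n}{m}$, and let $I_1,\dots,I_N$ be an enumeration of all $m$-element subsets of $\{1,\dots,n\}$. For $\Phi\in\mathcal A^{n\times m}$ put $d_k^{\Phi}=\det\Phi_{I_k}$, where $\Phi_{I_k}$ is the $m\times m$ submatrix of $\Phi$ consisting of the rows with index in $I_k$, and let $\Delta=[d_1^\Phi,d_2^\Phi,\dots,d_N^\Phi]^T\in\mathcal A^{N\times 1}$. (i) $\Phi\in\mathcal A^{n\times m}$ is left invertible over $\mathcal A$ if and only if the column $\Delta$ is left invertible over $\mathcal A$. (ii) If $\Phi\in\mathcal A^{n\times m}$ is left invertible over $\mathcal A$ with left inverse $\Psi\in\mathcal A^{m\times n}$, then the row $\Delta^*=[d_1^{\Psi^T},d_2^{\Psi^T},\dots,d_N^{\Psi^T}]$ is a left inverse of $\Delta$ over $\mathcal A$. (iii) If $\Delta$ is left invertible over $\mathcal A$ with a left inverse $\Delta^*=[\Delta_1^*,\Delta_2^*,\dots,\Delta_N^*]\in\mathcal A^{1\times N}$, then $$\Psi=\operatorname{diag}[(-1)^q]_{q=1,\dots,m}\ \sum_{k=1}^N\Delta_k^*\,\Phi_{I_k}^*$$ is a left inverse of $\Phi$ over $\mathcal A$, where the matrices $\Phi_{I_k}^*\in\mathcal A^{m\times n}$ are those defined in the context.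
   Context: An element $a\in\mathcal A^{n\times k}$ ($k\le n$) is left invertible over $\mathcal A$ if there is $b\in\mathcal A^{k\times n}$ (a left inverse of $a$) with $ba=I_k$. For $I\subset\{1,\dots,n\}$ with $m$ elements and $p\in I$, let $\nu_I(p)\in\{1,\dots,m\}$ be the position of $p$ when $I$ is listed in increasing order. Let $\Delta_{pq}^{\Phi_I}$ be the determinant of the $(m-1)\times(m-1)$ matrix obtained from $\Phi_I$ by deleting the row coming from row $p$ of $\Phi$ (the $\nu_I(p)$-th row of $\Phi_I$) and the $q$-th column (the determinant of a $0\times0$ matrix is $1$). The matrix $\Phi_I^*\in\mathcal A^{m\times n}$ has $(q,p)$-entry $(-1)^{\nu_I(p)}\Delta_{pq}^{\Phi_I}$ if $p\in I$, and $0$ if $p\notin I$. *)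

theory Defs
  imports
    "Jordan_Normal_Form.Determinant"
    "Jordan_Normal_Form.DL_Submatrix"
begin

text \<open>
  Matrices over a commutative ring are those of \<^theory>\<open>Jordan_Normal_Form.Matrix\<close>, whose row and
  column indices start at 0. Index sets are therefore subsets of \<open>{0..<n}\<close>; every sign below
  still uses the 1-based positions.
\<close>

definition is_left_inverse :: "'a::comm_ring_1 mat \<Rightarrow> 'a mat \<Rightarrow> bool" where
  "is_left_inverse b a \<longleftrightarrow>
     b \<in> carrier_mat (dim_col a) (dim_row a) \<and> b * a = 1\<^sub>m (dim_col a)"

definition left_invertible :: "'a::comm_ring_1 mat \<Rightarrow> bool" where
  "left_invertible a \<longleftrightarrow> (\<exists>b. is_left_inverse b a)"

definition row_submatrix :: "'a mat \<Rightarrow> nat set \<Rightarrow> 'a mat" where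
  "row_submatrix \<Phi> I = submatrix \<Phi> I UNIV"

definition row_minor :: "'a::comm_ring_1 mat \<Rightarrow> nat set \<Rightarrow> 'a" where
  "row_minor \<Phi> I = det (row_submatrix \<Phi> I)"

definition minors_col :: "nat \<Rightarrow> (nat \<Rightarrow> nat set) \<Rightarrow> 'a::comm_ring_1 mat \<Rightarrow> 'a mat" where
  "minors_col N I \<Phi> = mat N 1 (\<lambda>(k, _). row_minor \<Phi> (I k))"

definition minors_row :: "nat \<Rightarrow> (nat \<Rightarrow> nat set) \<Rightarrow> 'a::comm_ring_1 mat \<Rightarrow> 'a mat" where
  "minors_row N I \<Phi> = mat 1 N (\<lambda>(_, k). row_minor \<Phi> (I k))"

text \<open>The 1-based position of \<open>p \<in> I\<close> in the increasing listing of \<open>I\<close>.\<close>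

definition position :: "nat set \<Rightarrow> nat \<Rightarrow> nat" where
  "position I p = card {i \<in> I. i \<le> p}"

text \<open>
  The row of \<open>row_submatrix \<Phi> I\<close> that comes from row \<open>p\<close> of \<open>\<Phi>\<close> has the
  0-based index \<open>position I p - 1\<close>.
\<close>

definition deleted_minor :: "'a::comm_ring_1 mat \<Rightarrow> nat set \<Rightarrow> nat \<Rightarrow> nat \<Rightarrow> 'a" where
  "deleted_minor \<Phi> I p q = det (mat_delete (row_submatrix \<Phi> I) (position I p - 1) q)"

definition star_matrix :: "'a::comm_ring_1 mat \<Rightarrow> nat set \<Rightarrow> 'a mat" where
  "star_matrix \<Phi> I = mat (dim_col \<Phi>) (dim_row \<Phi>)
     (\<lambda>(q, p). if p \<in> I then (-1) ^ position I p * deleted_minor \<Phi> I p q else 0)"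

text \<open>
  The type of matrices of all dimensions has no zero, so \<^const>\<open>sum\<close> does not apply to it; the sum
  of a finite family of \<open>r \<times> c\<close> matrices is taken entrywise.
\<close>

definition matrix_sum :: "nat \<Rightarrow> nat \<Rightarrow> ('i \<Rightarrow> 'a::comm_monoid_add mat) \<Rightarrow> 'i set \<Rightarrow> 'a mat" where
  "matrix_sum r c F K = mat r c (\<lambda>(i, j). \<Sum>k\<in>K. F k $$ (i, j))"

end

theory Submission
  imports Defs
begin

text \<open>
  Everything rests on two identities for the maximal minors of a tall matrix \<open>\<Phi>\<close>.

  The Cauchy--Binet formula (\<open>Cauchy_Binet\<close>) writes \<open>det (\<Psi> * \<Phi>)\<close> as the sum over all \<open>m\<close>-subsets \<open>S\<close> of the
  products of the \<open>S\<close>-minors of \<open>\<Psi>\<^sup>T\<close> and of \<open>\<Phi>\<close>. If \<open>\<Psi> * \<Phi>\<close> is the identity, the left-hand side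
  is \<open>1\<close>, and the formula says that the row of minors of \<open>\<Psi>\<^sup>T\<close> is a left inverse of the column of
  minors of \<open>\<Phi>\<close>.

  Conversely, up to the signs \<open>(-1)^(q+1)\<close> of its rows, \<open>star_matrix \<Phi> S\<close> is the adjugate of the square
  block \<open>row_submatrix \<Phi> S\<close>, spread out over the columns in \<open>S\<close>. Multiplying it by \<open>\<Phi>\<close> therefore
  gives the \<open>S\<close>-minor times the identity (\<open>star_matrix_mult\<close>). A combination of these products
  whose coefficients form a left inverse of the column of minors is then the identity itself. The
  equivalence of the two kinds of left invertibility combines the two directions.
\<close>

section \<open>The increasing enumeration of an index set\<close>

lemma bij_betw_pick:
  assumes "finite S"
  shows "bij_betw (pick S) {0..<card S} S"
proof -
  have "inj_on (pick S) {0..<card S}"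
    by (rule inj_onI) (metis atLeastLessThan_iff card_pick_le)
  moreover have "pick S ` {0..<card S} \<subseteq> S"
    by (auto intro: pick_in_set_le)
  ultimately show ?thesis
    using assms by (simp add: bij_betw_def card_image card_subset_eq)
qed

lemma position_pick:
  assumes "finite S" and "i < card S"
  shows "position S (pick S i) = Suc i"
proof -
  have "{a \<in> S. a \<le> pick S i} = insert (pick S i) {a \<in> S. a < pick S i}"
    using pick_in_set_le[OF assms(2)] by auto
  then show ?thesis
    using assms by (simp add: position_def card_pick_le)
qed

lemma row_submatrix_eq_mat:
  assumes "\<Phi> \<in> carrier_mat n c" and "S \<subseteq> {0..<n}"
  shows "row_submatrix \<Phi> S = mat (card S) c (\<lambda>(i, j). \<Phi> $$ (pick S i, j))"
proof -
  have "{i. i < n \<and> i \<in> S} = S" using assms(2) by auto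
  then show ?thesis
    using assms(1) by (simp add: row_submatrix_def submatrix_def pick_UNIV)
qed

section \<open>The Cauchy--Binet formula\<close>

text \<open>
  An injective map from \<open>{0..<m}\<close> onto \<open>S\<close> is the increasing enumeration of \<open>S\<close> after a permutation.
  This turns the sum over injective maps that multilinearity produces into determinants. Maps are
  continued by the identity outside \<open>{0..<m}\<close>, which is the normal form of both permutations and
  the index set of \<open>det_linear_rows_sum\<close>.
\<close>

lemma bij_betw_permutes_pick:
  fixes S :: "nat set"
  assumes S: "finite S" and card: "card S = m"
  shows "bij_betw (\<lambda>\<sigma> i. if i < m then pick S (\<sigma> i) else i) {\<sigma>. \<sigma> permutes {0..<m}}
           {f. f ` {0..<m} = S \<and> (\<forall>i. i \<notin> {0..<m} \<longrightarrow> f i = i)}"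
    (is "bij_betw ?F ?P ?M")
  unfolding bij_betw_def
proof
  have bij: "bij_betw (pick S) {0..<m} S" using bij_betw_pick[OF S] card by simp
  show "inj_on ?F ?P"
  proof (rule inj_onI)
    fix \<sigma> \<tau> assume p: "\<sigma> \<in> ?P" "\<tau> \<in> ?P" and eq: "?F \<sigma> = ?F \<tau>"
    show "\<sigma> = \<tau>"
    proof
      fix i
      show "\<sigma> i = \<tau> i"
      proof (cases "i < m")
        case True
        then have "pick S (\<sigma> i) = pick S (\<tau> i)" using fun_cong[OF eq, of i] by simp
        moreover have "\<sigma> i \<in> {0..<m}" "\<tau> i \<in> {0..<m}"
          using p True permutes_in_image[of _ "{0..<m}" i] by auto
        ultimately show ?thesis using bij by (auto simp: bij_betw_def dest: inj_onD)
      next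
        case False
        then have "\<sigma> i = i" "\<tau> i = i" using p by (auto intro: permutes_not_in)
        then show ?thesis by simp
      qed
    qed
  qed
  show "?F ` ?P = ?M"
  proof
    show "?F ` ?P \<subseteq> ?M"
    proof clarify
      fix \<sigma> assume p: "\<sigma> permutes {0..<m}"
      have "?F \<sigma> ` {0..<m} = pick S ` \<sigma> ` {0..<m}" by (auto simp: image_image)
      then have "?F \<sigma> ` {0..<m} = S"
        using permutes_image[OF p] bij by (simp add: bij_betw_def)
      then show "?F \<sigma> ` {0..<m} = S \<and> (\<forall>i. i \<notin> {0..<m} \<longrightarrow> ?F \<sigma> i = i)" by simp
    qed
    show "?M \<subseteq> ?F ` ?P"
    proof
      fix f assume "f \<in> ?M"
      then have f: "f ` {0..<m} = S" and id: "\<forall>i. i \<notin> {0..<m} \<longrightarrow> f i = i" by auto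
      have "bij_betw f {0..<m} S"
        using card f by (simp add: bij_betw_def eq_card_imp_inj_on)
      define \<sigma> where "\<sigma> i = (if i \<in> {0..<m} then inv_into {0..<m} (pick S) (f i) else i)" for i
      have "bij_betw (inv_into {0..<m} (pick S) \<circ> f) {0..<m} {0..<m}"
        using \<open>bij_betw f {0..<m} S\<close> bij_betw_inv_into[OF bij] by (rule bij_betw_trans)
      then have "bij_betw \<sigma> {0..<m} {0..<m}"
        by (rule bij_betw_cong[THEN iffD1, rotated]) (simp add: \<sigma>_def)
      then have p: "\<sigma> permutes {0..<m}"
        by (rule bij_imp_permutes) (simp add: \<sigma>_def)
      have "?F \<sigma> = f"
      proof
        fix i show "?F \<sigma> i = f i"
          using id f bij by (auto simp: \<sigma>_def bij_betw_def f_inv_into_f)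
      qed
      then show "f \<in> ?F ` ?P" using p by (intro image_eqI[of _ _ \<sigma>]) auto
    qed
  qed
qed

text \<open>
  The part of the Cauchy--Binet sum that belongs to one \<open>S\<close>: permuting the rows of the block of \<open>B\<close>
  produces the sign that the Leibniz formula for the block of \<open>A\<close> requires.
\<close>

lemma sum_maps_onto_eq_minors:
  fixes A B :: "'a::comm_ring_1 mat"
  assumes A: "A \<in> carrier_mat m n" and B: "B \<in> carrier_mat n m"
    and S: "S \<subseteq> {0..<n}" and card: "card S = m"
  shows "(\<Sum>f | f ` {0..<m} = S \<and> (\<forall>i. i \<notin> {0..<m} \<longrightarrow> f i = i).
            (\<Prod>i = 0..<m. A $$ (i, f i)) * det (mat\<^sub>r m m (\<lambda>i. row B (f i))))
         = row_minor (transpose_mat A) S * row_minor B S"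
    (is "sum ?t ?M = _")
proof -
  have fin: "finite S" using S finite_subset by blast
  define BS where "BS = row_submatrix B S"
  have BS: "BS = mat m m (\<lambda>(i, j). B $$ (pick S i, j))"
    unfolding BS_def using row_submatrix_eq_mat[OF B S] card by simp
  have AS: "row_submatrix (transpose_mat A) S = mat m m (\<lambda>(i, j). A $$ (j, pick S i))"
  proof -
    have "pick S i < n" if "i < m" for i
      using pick_in_set_le[of i S] that S card by auto
    then show ?thesis
      using row_submatrix_eq_mat[of "transpose_mat A" n m S] A S card by (auto intro!: eq_matI)
  qed
  let ?F = "\<lambda>\<sigma> i. if i < m then pick S (\<sigma> i) else i"
  let ?P = "{\<sigma>. \<sigma> permutes {0..<m}}"
  have "sum ?t ?M = (\<Sum>\<sigma>\<in>?P. ?t (?F \<sigma>))"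
    by (rule sum.reindex_bij_betw[OF bij_betw_permutes_pick[OF fin card], symmetric])
  also have "\<dots> = (\<Sum>\<sigma>\<in>?P. (signof \<sigma> * (\<Prod>i = 0..<m. A $$ (i, pick S (\<sigma> i)))) * det BS)"
  proof (rule sum.cong[OF refl])
    fix \<sigma> assume "\<sigma> \<in> ?P"
    then have p: "\<sigma> permutes {0..<m}" by simp
    have less: "\<sigma> i < m" if "i < m" for i
      using permutes_in_image[OF p, of i] that by simp
    have "pick S (\<sigma> i) < n" if "i < m" for i
      using pick_in_set_le[of "\<sigma> i" S] less[OF that] S card by auto
    then have "mat\<^sub>r m m (\<lambda>i. row B (?F \<sigma> i)) = mat m m (\<lambda>(i, j). BS $$ (\<sigma> i, j))"
      using B less by (auto simp: BS intro!: eq_matI)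
    moreover have "det (mat m m (\<lambda>(i, j). BS $$ (\<sigma> i, j))) = signof \<sigma> * det BS"
      by (rule det_permute_rows[OF _ p]) (simp add: BS)
    ultimately show "?t (?F \<sigma>) =
        (signof \<sigma> * (\<Prod>i = 0..<m. A $$ (i, pick S (\<sigma> i)))) * det BS"
      by (simp add: ac_simps)
  qed
  also have "\<dots> = det (mat m m (\<lambda>(i, j). A $$ (i, pick S j))) * det BS"
  proof -
    have "(\<Prod>i = 0..<m. mat m m (\<lambda>(i, j). A $$ (i, pick S j)) $$ (i, \<sigma> i))
          = (\<Prod>i = 0..<m. A $$ (i, pick S (\<sigma> i)))" if "\<sigma> permutes {0..<m}" for \<sigma>
      using permutes_in_image[OF that] by (intro prod.cong) auto
    then show ?thesis
      by (simp add: det_def'[of _ m] sum_distrib_right)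
  qed
  also have "mat m m (\<lambda>(i, j). A $$ (i, pick S j))
             = transpose_mat (row_submatrix (transpose_mat A) S)"
    by (auto simp: AS intro!: eq_matI)
  also have "det \<dots> = row_minor (transpose_mat A) S"
    unfolding row_minor_def by (rule det_transpose[of _ m]) (simp add: AS)
  finally show ?thesis
    by (simp add: row_minor_def BS_def)
qed

text \<open>
  Row \<open>i\<close> of \<open>A * B\<close> is a combination of the rows of \<open>B\<close>. Expanding the determinant by
  multilinearity leaves one term per choice \<open>f\<close> of a row of \<open>B\<close> for each \<open>i\<close>. A choice that repeats
  a row contributes nothing, and the remaining ones are sorted by their image.
\<close>

theorem Cauchy_Binet:
  fixes A B :: "'a::comm_ring_1 mat"
  assumes A: "A \<in> carrier_mat m n" and B: "B \<in> carrier_mat n m"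
  shows "det (A * B) =
    (\<Sum>S | S \<subseteq> {0..<n} \<and> card S = m. row_minor (transpose_mat A) S * row_minor B S)"
proof -
  let ?Fun = "{f. (\<forall>i\<in>{0..<m}. f i \<in> {0..<n}) \<and> (\<forall>i. i \<notin> {0..<m} \<longrightarrow> f i = i)}"
  let ?Sub = "{S. S \<subseteq> {0..<n} \<and> card S = m}"
  let ?t = "\<lambda>f. (\<Prod>i = 0..<m. A $$ (i, f i)) * det (mat\<^sub>r m m (\<lambda>i. row B (f i)))"
  let ?Inj = "{f \<in> ?Fun. inj_on f {0..<m}}"
  have fin: "finite ?Fun" by (rule finite_bounded_functions) auto
  have "det (A * B) = (\<Sum>f\<in>?Fun. det (mat\<^sub>r m m (\<lambda>i. A $$ (i, f i) \<cdot>\<^sub>v row B (f i))))"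
    unfolding mat_mul_finsum_alt[OF A B]
    by (rule det_linear_rows_sum) (use A B in auto)
  also have "\<dots> = (\<Sum>f\<in>?Fun. ?t f)"
    by (intro sum.cong refl det_rows_mul) (use B in auto)
  also have "\<dots> = (\<Sum>f\<in>?Inj. ?t f)"
  proof (rule sum.mono_neutral_right[OF fin])
    show "\<forall>f\<in>?Fun - ?Inj. ?t f = 0"
    proof
      fix f assume "f \<in> ?Fun - ?Inj"
      then obtain i j where ij: "i \<noteq> j" "i < m" "j < m" "f i = f j"
        by (auto simp: inj_on_def)
      let ?R = "mat\<^sub>r m m (\<lambda>i. row B (f i))"
      have "row ?R i = row ?R j" using ij B by simp
      then have "det ?R = 0" by (rule det_identical_rows[OF mat_row_carrierI ij(1-3)])
      then show "?t f = 0" by simp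
    qed
  qed auto
  also have "\<dots> = (\<Sum>S\<in>?Sub. \<Sum>f | f \<in> ?Inj \<and> f ` {0..<m} = S. ?t f)"
  proof (rule sum.group[symmetric])
    show "finite ?Inj" by (rule finite_subset[OF _ fin]) blast
    show "(\<lambda>f. f ` {0..<m}) ` ?Inj \<subseteq> ?Sub" by (auto simp: card_image)
  qed simp
  also have "\<dots> = (\<Sum>S\<in>?Sub. row_minor (transpose_mat A) S * row_minor B S)"
  proof (rule sum.cong[OF refl])
    fix S assume "S \<in> ?Sub"
    then have S: "S \<subseteq> {0..<n}" "card S = m" by auto
    have "{f. f \<in> ?Inj \<and> f ` {0..<m} = S}
          = {f. f ` {0..<m} = S \<and> (\<forall>i. i \<notin> {0..<m} \<longrightarrow> f i = i)}"
    proof (intro Collect_cong iffI)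
      fix f assume f: "f ` {0..<m} = S \<and> (\<forall>i. i \<notin> {0..<m} \<longrightarrow> f i = i)"
      have "inj_on f {0..<m}" by (rule eq_card_imp_inj_on) (use f S in auto)
      moreover have "\<forall>i\<in>{0..<m}. f i \<in> {0..<n}" using f S(1) by blast
      ultimately show "f \<in> ?Inj \<and> f ` {0..<m} = S" using f by simp
    qed simp
    then show "(\<Sum>f | f \<in> ?Inj \<and> f ` {0..<m} = S. ?t f)
               = row_minor (transpose_mat A) S * row_minor B S"
      using sum_maps_onto_eq_minors[OF A B S] by simp
  qed
  finally show ?thesis .
qed

section \<open>The spread-out adjugate\<close>

text \<open>
  Only the rows \<open>p \<in> S\<close> of \<open>\<Phi>\<close> contribute. Numbered by their positions in \<open>S\<close>, they make the sum an
  entry of the product of the adjugate of \<open>row_submatrix \<Phi> S\<close> with that block; the signs agree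
  because both the row and the column are counted from 1 here and from 0 in the cofactors.
\<close>

lemma star_matrix_mult:
  fixes \<Phi> :: "'a::comm_ring_1 mat"
  assumes \<Phi>: "\<Phi> \<in> carrier_mat n m" and S: "S \<subseteq> {0..<n}" and card: "card S = m"
    and q: "q < m" and j: "j < m"
  shows "(\<Sum>p = 0..<n. (-1) ^ (q + 1) * star_matrix \<Phi> S $$ (q, p) * \<Phi> $$ (p, j))
         = (if q = j then row_minor \<Phi> S else 0)"
proof -
  have fin: "finite S" using S finite_subset by blast
  define A where "A = row_submatrix \<Phi> S"
  have A_eq: "A = mat m m (\<lambda>(i, j). \<Phi> $$ (pick S i, j))"
    unfolding A_def using row_submatrix_eq_mat[OF \<Phi> S] card by simp
  then have A: "A \<in> carrier_mat m m" by simp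
  let ?g = "\<lambda>p. (-1) ^ (q + 1) * ((-1) ^ position S p * deleted_minor \<Phi> S p q) * \<Phi> $$ (p, j)"
  have "(\<Sum>p = 0..<n. (-1) ^ (q + 1) * star_matrix \<Phi> S $$ (q, p) * \<Phi> $$ (p, j))
        = (\<Sum>p = 0..<n. if p \<in> S then ?g p else 0)"
    using \<Phi> q by (intro sum.cong) (auto simp: star_matrix_def)
  also have "\<dots> = sum ?g S"
    using S by (simp add: sum.inter_restrict[symmetric] Int_absorb1)
  also have "\<dots> = (\<Sum>i = 0..<m. ?g (pick S i))"
    using bij_betw_pick[OF fin] card by (simp add: sum.reindex_bij_betw[symmetric])
  also have "\<dots> = (\<Sum>i = 0..<m. adj_mat A $$ (q, i) * A $$ (i, j))"
  proof (rule sum.cong[OF refl])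
    fix i assume "i \<in> {0..<m}"
    then have i: "i < m" by simp
    have "adj_mat A $$ (q, i) = (-1) ^ (i + q) * det (mat_delete A i q)"
      using A q i by (simp add: adj_mat_def cofactor_def)
    moreover have "deleted_minor \<Phi> S (pick S i) q = det (mat_delete A i q)"
      using position_pick[OF fin, of i] card i by (simp add: deleted_minor_def A_def)
    moreover have "A $$ (i, j) = \<Phi> $$ (pick S i, j)"
      using i j by (simp add: A_eq)
    ultimately show "?g (pick S i) = adj_mat A $$ (q, i) * A $$ (i, j)"
      using position_pick[OF fin, of i] card i by (simp add: power_add ac_simps)
  qed
  also have "\<dots> = (adj_mat A * A) $$ (q, j)"
    using A adj_mat(1)[OF A] q j by (simp add: scalar_prod_def)
  also have "\<dots> = (if q = j then row_minor \<Phi> S else 0)"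
    using adj_mat(3)[OF A] q j by (simp add: row_minor_def A_def)
  finally show ?thesis .
qed

section \<open>Left inverses of a matrix and of its column of minors\<close>

lemma is_left_inverse_minors_col_iff:
  "is_left_inverse b (minors_col N I \<Phi>) \<longleftrightarrow>
     b \<in> carrier_mat 1 N \<and> (\<Sum>k = 0..<N. b $$ (0, k) * row_minor \<Phi> (I k)) = 1"
proof -
  have "b * minors_col N I \<Phi> = 1\<^sub>m 1 \<longleftrightarrow>
        (\<Sum>k = 0..<N. b $$ (0, k) * row_minor \<Phi> (I k)) = 1" if b: "b \<in> carrier_mat 1 N"
  proof -
    have "(b * minors_col N I \<Phi>) $$ (0, 0) = (\<Sum>k = 0..<N. b $$ (0, k) * row_minor \<Phi> (I k))"
      using b by (simp add: minors_col_def scalar_prod_def)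
    moreover have "b * minors_col N I \<Phi> = 1\<^sub>m 1 \<longleftrightarrow> (b * minors_col N I \<Phi>) $$ (0, 0) = 1"
      using b by (auto simp: mat_eq_iff minors_col_def)
    ultimately show ?thesis by simp
  qed
  then show ?thesis by (auto simp: is_left_inverse_def minors_col_def)
qed

lemma minors_row_is_left_inverse:
  fixes \<Phi> \<Psi> :: "'a::comm_ring_1 mat"
  assumes I: "bij_betw I {0..<N} {S. S \<subseteq> {0..<n} \<and> card S = m}"
    and \<Phi>: "\<Phi> \<in> carrier_mat n m" and inv: "is_left_inverse \<Psi> \<Phi>"
  shows "is_left_inverse (minors_row N I (transpose_mat \<Psi>)) (minors_col N I \<Phi>)"
proof -
  have \<Psi>: "\<Psi> \<in> carrier_mat m n" and id: "\<Psi> * \<Phi> = 1\<^sub>m m"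
    using inv \<Phi> by (auto simp: is_left_inverse_def)
  have "(\<Sum>k = 0..<N. row_minor (transpose_mat \<Psi>) (I k) * row_minor \<Phi> (I k)) = det (\<Psi> * \<Phi>)"
    unfolding Cauchy_Binet[OF \<Psi> \<Phi>] by (rule sum.reindex_bij_betw[OF I])
  then show ?thesis
    by (simp add: is_left_inverse_minors_col_iff minors_row_def id)
qed

lemma star_combination_is_left_inverse:
  fixes \<Phi> \<Delta>s :: "'a::comm_ring_1 mat"
  assumes I: "\<And>k. k < N \<Longrightarrow> I k \<subseteq> {0..<n} \<and> card (I k) = m"
    and \<Phi>: "\<Phi> \<in> carrier_mat n m" and inv: "is_left_inverse \<Delta>s (minors_col N I \<Phi>)"
  shows "is_left_inverse
           (mat_diag m (\<lambda>q. (-1) ^ (q + 1)) *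
            matrix_sum m n (\<lambda>k. \<Delta>s $$ (0, k) \<cdot>\<^sub>m star_matrix \<Phi> (I k)) {0..<N}) \<Phi>"
    (is "is_left_inverse (?D * ?X) \<Phi>")
proof -
  have sum1: "(\<Sum>k = 0..<N. \<Delta>s $$ (0, k) * row_minor \<Phi> (I k)) = 1"
    using inv by (simp add: is_left_inverse_minors_col_iff)
  have X: "?X \<in> carrier_mat m n" by (simp add: matrix_sum_def)
  have DX: "?D * ?X = mat m n (\<lambda>(q, p). (-1) ^ (q + 1) * ?X $$ (q, p))"
    by (rule mat_diag_mult_left[OF X])
  have X_index: "?X $$ (q, p) = (\<Sum>k = 0..<N. \<Delta>s $$ (0, k) * star_matrix \<Phi> (I k) $$ (q, p))"
    if "q < m" "p < n" for q p
    using that \<Phi> by (auto simp: matrix_sum_def star_matrix_def intro!: sum.cong)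
  have "?D * ?X * \<Phi> = 1\<^sub>m m"
  proof (rule eq_matI)
    fix q j assume "q < dim_row (1\<^sub>m m)" and "j < dim_col (1\<^sub>m m)"
    then have q: "q < m" and j: "j < m" by auto
    have "(?D * ?X * \<Phi>) $$ (q, j) = (\<Sum>p = 0..<n. (-1) ^ (q + 1) * ?X $$ (q, p) * \<Phi> $$ (p, j))"
      unfolding DX using q j \<Phi> by (simp add: scalar_prod_def)
    also have "\<dots> = (\<Sum>p = 0..<n. \<Sum>k = 0..<N.
        \<Delta>s $$ (0, k) * ((-1) ^ (q + 1) * star_matrix \<Phi> (I k) $$ (q, p) * \<Phi> $$ (p, j)))"
      using q by (intro sum.cong refl)
        (simp add: X_index sum_distrib_left sum_distrib_right ac_simps del: power_Suc)
    also have "\<dots> = (\<Sum>k = 0..<N. \<Delta>s $$ (0, k) *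
        (\<Sum>p = 0..<n. (-1) ^ (q + 1) * star_matrix \<Phi> (I k) $$ (q, p) * \<Phi> $$ (p, j)))"
      by (subst sum.swap) (simp only: sum_distrib_left)
    also have "\<dots> = (\<Sum>k = 0..<N. \<Delta>s $$ (0, k) * (if q = j then row_minor \<Phi> (I k) else 0))"
      by (intro sum.cong refl arg_cong2[where f = "(*)"] star_matrix_mult[OF \<Phi> _ _ q j])
        (use I in auto)
    also have "\<dots> = 1\<^sub>m m $$ (q, j)"
      using sum1 q j by simp
    finally show "(?D * ?X * \<Phi>) $$ (q, j) = 1\<^sub>m m $$ (q, j)" .
  qed (use \<Phi> in \<open>auto simp: mat_diag_def\<close>)
  then show ?thesis
    using \<Phi> DX by (simp add: is_left_inverse_def)
qed

theorem theorem2: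
  fixes \<Phi> :: "'a::comm_ring_1 mat"
    and n m N :: nat
    and I :: "nat \<Rightarrow> nat set"
  assumes "1 \<le> m" and "m \<le> n"
    and "N = n choose m"
    and "bij_betw I {0..<N} {J. J \<subseteq> {0..<n} \<and> card J = m}"
    and "\<Phi> \<in> carrier_mat n m"
  shows "(left_invertible \<Phi> \<longleftrightarrow> left_invertible (minors_col N I \<Phi>))
    \<and> (\<forall>\<Psi>. is_left_inverse \<Psi> \<Phi> \<longrightarrow>
          is_left_inverse (minors_row N I (transpose_mat \<Psi>)) (minors_col N I \<Phi>))
    \<and> (\<forall>\<Delta>s. is_left_inverse \<Delta>s (minors_col N I \<Phi>) \<longrightarrow>
          is_left_inverse
            (mat_diag m (\<lambda>q. (-1) ^ (q + 1)) *
             matrix_sum m n (\<lambda>k. \<Delta>s $$ (0, k) \<cdot>\<^sub>m star_matrix \<Phi> (I k)) {0..<N})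
            \<Phi>)"
proof -
  have I: "I k \<subseteq> {0..<n} \<and> card (I k) = m" if "k < N" for k
    using bij_betwE[OF assms(4)] that by auto
  note to_col = minors_row_is_left_inverse[OF assms(4,5)]
  note to_mat = star_combination_is_left_inverse[of N I, OF I assms(5)]
  show ?thesis
    unfolding left_invertible_def using to_col to_mat by blast
qed

end
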